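(* Let $(G_n)_{n\ge 0}$ be the sequence of graphs with special vertices $X_n,Y_n$ defined in the context, let $T_n(x,y)=T(G_n;x,y)$ be the Tutte polynomial of $G_n$, and let $T_{1,n}(x,y)$, $T_{2,n}(x,y)$ be the partial sums defined in the context. Then for every $n\ge 0$ the Tutte polynomial of $G_{n+1}$ is given by $$T_{n+1}(x,y)=T_{1,n+1}(x,y)+T_{2,n+1}(x,y),$$ where the polynomials $T_{1,n+1}$ and $T_{2,n+1}$ satisfy the following recursive relations (as identities of rational functions in $x,y$, with $T_{i,n}=T_{i,n}(x,y)$): $$T_{1,n+1}(x,y)=y(y-1)\,T_{1,n}^4+\frac{4y}{x-1}\,T_{1,n}^{3}T_{2,n}+\frac{2x+2}{(x-1)^{2}}\,T_{1,n}^{2}T_{2,n}^2,$$ $$T_{2,n+1}(x,y)=\frac{2y+2}{x-1}\,T_{1,n}^{2}T_{2,n}^2+\frac{4x}{(x-1)^{2}}\,T_{1,n}T_{2,n}^{3}+\frac{x}{(x-1)^{2}}\,T_{2,n}^4,$$ with initial conditions $T_{1,0}(x,y)=1$ and $T_{2,0}(x,y)=x-1$.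
   Context: Tutte polynomial: for a graph $G$ with vertex set $V(G)$, edge set $E(G)$ and $k(G)$ connected components, put $r(G)=|V(G)|-k(G)$ and $n(G)=|E(G)|-|V(G)|+k(G)$. Then $T(G;x,y)=\sum_{H\subseteq G}(x-1)^{r(G)-r(H)}(y-1)^{n(H)}$, where the sum runs over all spanning subgraphs $H$ of $G$ (subgraphs with $V(H)=V(G)$ and arbitrary $E(H)\subseteq E(G)$). The graphs $G_n$: $G_0$ is the complete graph $K_2$ with its two vertices denoted $X_0,Y_0$. For $n\ge 0$, given $G_n$ with two special vertices $X_n,Y_n$, take four disjoint copies $G_n^1,G_n^2,G_n^3,G_n^4$ of $G_n$, with special vertices $X_n^i,Y_n^i$. Identify $X_n^1$ with $X_n^2$ to form the special vertex $X_{n+1}$ of $G_{n+1}$; identify $Y_n^3$ with $Y_n^4$ to form the special vertex $Y_{n+1}$ of $G_{n+1}$; identify $Y_n^1$ with $X_n^3$ to form a vertex $a$, and $Y_n^2$ with $X_n^4$ to form a vertex $b$; finally add a new edge $e_n$ joining $a$ and $b$. The result is $G_{n+1}$. Partial sums: let $\mathcal{G}_{1,n}$ be the set of spanning subgraphs $H$ of $G_n$ in which $X_n$ and $Y_n$ belong to the same connected component of $H$, and $\mathcal{G}_{2,n}$ the set of spanning subgraphs in which $X_n$ and $Y_n$ do not belong to the same component. For $i=1,2$, $T_{i,n}(x,y)=\sum_{H\in\mathcal{G}_{i,n}}(x-1)^{r(G_n)-r(H)}(y-1)^{n(H)}$. *)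

theory Defs
  imports "HOL-Computational_Algebra.Polynomial_Factorial"
begin

(* Undirected multigraphs. An edge with a one-element set of ends is a loop. Edges have names of
   their own, so that identifying vertices can never merge or delete edges. *)
record ('v, 'e) mgraph =
  verts :: "'v set"
  edges :: "'e set"
  ends :: "'e \<Rightarrow> 'v set"

definition adj_rel :: "('v, 'e) mgraph \<Rightarrow> ('v \<times> 'v) set" where
  "adj_rel G = {(u, v). \<exists>e\<in>edges G. ends G e = {u, v}}"

definition components :: "('v, 'e) mgraph \<Rightarrow> 'v set set" where
  "components G = verts G // {(u, v) \<in> verts G \<times> verts G. (u, v) \<in> (adj_rel G)\<^sup>*}"

definition same_component :: "('v, 'e) mgraph \<Rightarrow> 'v \<Rightarrow> 'v \<Rightarrow> bool" where
  "same_component G u v \<longleftrightarrow> (\<exists>C\<in>components G. u \<in> C \<and> v \<in> C)"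

(* On a finite graph there are at most as many components as vertices, and |V| <= |E| + k;
   hence the subtractions of natural numbers in rank and nullity do not truncate. *)
definition num_comps :: "('v, 'e) mgraph \<Rightarrow> nat" where
  "num_comps G = card (components G)"

definition rank :: "('v, 'e) mgraph \<Rightarrow> nat" where
  "rank G = card (verts G) - num_comps G"

definition nullity :: "('v, 'e) mgraph \<Rightarrow> nat" where
  "nullity G = card (edges G) + num_comps G - card (verts G)"

(* H has the same ends function as G on all of the type, also outside edges H, so the spanning
   subgraphs of G correspond one-to-one to the subsets of edges G. *)
definition spanning_subgraphs :: "('v, 'e) mgraph \<Rightarrow> ('v, 'e) mgraph set" where
  "spanning_subgraphs G = {H. verts H = verts G \<and> edges H \<subseteq> edges G \<and> ends H = ends G}"

(* Z[x,y] is represented as Z[x][y]: the variable of the inner polynomial is x, that of the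
   outer polynomial is y. *)
type_synonym bipoly = "int poly poly"

definition var_x :: bipoly where "var_x = [:[:0, 1:]:]"
definition var_y :: bipoly where "var_y = [:0, 1:]"

(* rank H <= rank G for a spanning subgraph H of G, so the exponent does not truncate. *)
definition tutte_term :: "('v, 'e) mgraph \<Rightarrow> ('v, 'e) mgraph \<Rightarrow> bipoly" where
  "tutte_term G H = (var_x - 1) ^ (rank G - rank H) * (var_y - 1) ^ nullity H"

definition tutte :: "('v, 'e) mgraph \<Rightarrow> bipoly" where
  "tutte G = (\<Sum>H\<in>spanning_subgraphs G. tutte_term G H)"

(* VCopy i v and ECopy i e are the vertex v and the edge e in the i-th copy of a graph; ENew is
   the edge added at the current stage, whereas one added at an earlier stage has become
   ECopy i (... ENew). *)
datatype vname = VLeft | VRight | VCopy nat vname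
datatype ename = EBase | ECopy nat ename | ENew

type_synonym graph = "(vname, ename) mgraph"

definition four_copies :: "graph \<Rightarrow> graph" where
  "four_copies G =
    \<lparr> verts = (\<Union>i\<in>{1..4}. VCopy i ` verts G),
      edges = (\<Union>i\<in>{1..4}. ECopy i ` edges G),
      ends = (\<lambda>e. case e of ECopy i e' \<Rightarrow> VCopy i ` ends G e' | _ \<Rightarrow> {}) \<rparr>"

(* The vertex resulting from the identification of u and v is called u. *)
definition identify :: "'v \<Rightarrow> 'v \<Rightarrow> ('v, 'e) mgraph \<Rightarrow> ('v, 'e) mgraph" where
  "identify u v G =
    (let q = (\<lambda>w. if w = v then u else w)
     in \<lparr> verts = q ` verts G, edges = edges G, ends = (\<lambda>e. q ` ends G e) \<rparr>)"

definition add_edge :: "'e \<Rightarrow> 'v \<Rightarrow> 'v \<Rightarrow> ('v, 'e) mgraph \<Rightarrow> ('v, 'e) mgraph" where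
  "add_edge e u v G = G \<lparr> edges := insert e (edges G), ends := (ends G)(e := {u, v}) \<rparr>"

definition K2 :: graph where
  "K2 = \<lparr> verts = {VLeft, VRight}, edges = {EBase}, ends = (\<lambda>_. {VLeft, VRight}) \<rparr>"

primrec X :: "nat \<Rightarrow> vname" where
  "X 0 = VLeft"
| "X (Suc n) = VCopy 1 (X n)"

primrec Y :: "nat \<Rightarrow> vname" where
  "Y 0 = VRight"
| "Y (Suc n) = VCopy 3 (Y n)"

primrec G :: "nat \<Rightarrow> graph" where
  "G 0 = K2"
| "G (Suc n) =
    (let a = VCopy 1 (Y n); b = VCopy 2 (Y n) in
     add_edge ENew a b
      (identify b (VCopy 4 (X n))
      (identify a (VCopy 3 (X n))
      (identify (VCopy 3 (Y n)) (VCopy 4 (Y n))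
      (identify (VCopy 1 (X n)) (VCopy 2 (X n))
      (four_copies (G n)))))))"

definition T :: "nat \<Rightarrow> bipoly" where
  "T n = tutte (G n)"

definition T1 :: "nat \<Rightarrow> bipoly" where
  "T1 n = (\<Sum>H\<in>{H \<in> spanning_subgraphs (G n). same_component H (X n) (Y n)}.
    tutte_term (G n) H)"

definition T2 :: "nat \<Rightarrow> bipoly" where
  "T2 n = (\<Sum>H\<in>{H \<in> spanning_subgraphs (G n). \<not> same_component H (X n) (Y n)}.
    tutte_term (G n) H)"

(* The same objects in the field of rational functions, the fraction field of Z[x,y]. *)
abbreviation rx :: "bipoly fract" where "rx \<equiv> to_fract var_x"
abbreviation ry :: "bipoly fract" where "ry \<equiv> to_fract var_y"
abbreviation R1 :: "nat \<Rightarrow> bipoly fract" where "R1 n \<equiv> to_fract (T1 n)"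
abbreviation R2 :: "nat \<Rightarrow> bipoly fract" where "R2 n \<equiv> to_fract (T2 n)"

end

theory Submission
  imports Defs
begin

text \<open>
  Whether the copies of a spanning subgraph connect their terminals, together with the presence
  of the new edge, determines by how much the number of components drops when the copies are glued.
  Each identification, and likewise the new edge, merges two components unless its two vertices are
  already connected. With \<open>m\<close> mergers, \<open>k(H) = k(H\<^sub>1) + \<dots> + k(H\<^sub>4) - m\<close>; hence the term of \<open>H\<close> is the
  product of the terms of the \<open>H\<^sub>i\<close> times \<open>(x - 1)\<^bsup>3 - m\<^esup> (y - 1)\<^bsup>4 + d - m\<^esup>\<close>, where \<open>d\<close> is 1 or 0 according to
  the presence of the new edge. Summing over the 32 cases gives the recursion.
\<close>

section \<open>Connectivity and component counts of finite multigraphs\<close>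

text \<open>Only names in \<open>edges M\<close> are constrained, since \<open>ends\<close> is total
  on its type; \<open>c = d\<close> admits loops. Being a condition on each edge separately, it
  survives the deletion of edges.\<close>

definition wf_graph :: "('v, 'e) mgraph \<Rightarrow> bool" where
  "wf_graph M \<longleftrightarrow> finite (verts M) \<and> finite (edges M) \<and>
    (\<forall>e\<in>edges M. \<exists>c\<in>verts M. \<exists>d\<in>verts M. ends M e = {c, d})"

lemma wf_graph_ends:
  assumes "wf_graph M" "e \<in> edges M"
  obtains c d where "c \<in> verts M" "d \<in> verts M" "ends M e = {c, d}"
  using assms unfolding wf_graph_def by blast

text \<open>The relation whose quotient is \<open>components\<close>, named so that facts about
  equivalence relations and quotients apply.\<close>

definition conn :: "('v, 'e) mgraph \<Rightarrow> ('v \<times> 'v) set" where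
  "conn M = {(u, v) \<in> verts M \<times> verts M. (u, v) \<in> (adj_rel M)\<^sup>*}"

lemma sym_adj_rel: "sym (adj_rel M)"
  by (auto simp: sym_def adj_rel_def insert_commute)

lemma equiv_conn: "equiv (verts M) (conn M)"
proof (rule equivI)
  show "sym (conn M)"
    using sym_rtrancl[OF sym_adj_rel[of M]] by (auto simp: sym_def conn_def)
  show "trans (conn M)"
    by (auto simp: trans_def conn_def intro: rtrancl_trans)
qed (auto simp: conn_def refl_on_def)

lemma components_eq: "components M = verts M // conn M"
  by (simp add: components_def conn_def)

lemma same_component_iff:
  "same_component M u v \<longleftrightarrow> u \<in> verts M \<and> v \<in> verts M \<and> (u, v) \<in> (adj_rel M)\<^sup>*"
proof -
  have "same_component M u v \<longleftrightarrow> (u, v) \<in> conn M"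
  proof
    assume "same_component M u v"
    then obtain C where "C \<in> verts M // conn M" "u \<in> C" "v \<in> C"
      by (auto simp: same_component_def components_eq)
    then show "(u, v) \<in> conn M"
      using quotient_eq_iff[OF equiv_conn[of M]] by blast
  next
    assume uv: "(u, v) \<in> conn M"
    then have "u \<in> verts M" by (simp add: conn_def)
    then have "conn M `` {u} \<in> components M" "u \<in> conn M `` {u}"
      using equiv_class_self[OF equiv_conn] by (auto simp: components_eq quotientI)
    then show "same_component M u v"
      using uv unfolding same_component_def by blast
  qed
  then show ?thesis by (simp add: conn_def)
qed

lemma conn_iff: "(u, v) \<in> conn M \<longleftrightarrow> same_component M u v"
  by (auto simp: conn_def same_component_iff)

lemma same_component_refl: "u \<in> verts M \<Longrightarrow> same_component M u u"
  by (simp add: same_component_iff)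

lemma same_component_sym: "same_component M u v \<longleftrightarrow> same_component M v u"
  using equiv_conn[of M] by (metis conn_iff equiv_def symD)

text \<open>Lets two records be exchanged that differ only in the \<open>ends\<close> of absent
  edges, as happens when the new edge is left out.\<close>

lemma num_comps_cong:
  assumes "verts M = verts N" "adj_rel M = adj_rel N"
  shows "num_comps M = num_comps N"
  using assms by (simp add: num_comps_def components_def)

lemma same_component_cong:
  assumes "verts M = verts N" "adj_rel M = adj_rel N"
  shows "same_component M = same_component N"
  using assms by (simp add: fun_eq_iff same_component_iff)

lemma finite_components: "finite (verts M) \<Longrightarrow> finite (components M)"
  unfolding components_eq by (rule finite_quotient) (auto simp: conn_def)

lemma num_comps_le_verts: "finite (verts M) \<Longrightarrow> num_comps M \<le> card (verts M)"
  by (simp add: num_comps_def components_def quotient_def UNION_singleton_eq_range card_image_le)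

lemma num_comps_pos: "finite (verts M) \<Longrightarrow> verts M \<noteq> {} \<Longrightarrow> 1 \<le> num_comps M"
  using finite_components[of M]
  by (auto simp: num_comps_def Suc_le_eq card_gt_0_iff components_eq quotient_def)

text \<open>
  Instantiated with the identity map for adding an edge \<open>uv\<close>, and with the quotient map for
  identifying \<open>u\<close> and \<open>v\<close>.
\<close>

lemma card_quotient_merge:
  assumes fin: "finite A" and R: "equiv A R" and S: "equiv B S"
    and f: "f ` A = B" and u: "u \<in> A" and v: "v \<in> A"
    and S_iff: "\<And>a b. a \<in> A \<Longrightarrow> b \<in> A \<Longrightarrow> (f a, f b) \<in> S \<longleftrightarrow>
      (a, b) \<in> R \<or> (a, u) \<in> R \<and> (v, b) \<in> R \<or> (a, v) \<in> R \<and> (u, b) \<in> R"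
  shows "card (B // S) + (if (u, v) \<in> R then 0 else 1) = card (A // R)"
proof -
  \<comment> \<open>The map induced by \<open>f\<close> on classes, written as a saturated image to
    avoid choosing representatives.\<close>
  define g where "g C = S `` (f ` C)" for C
  have RA: "R \<subseteq> A \<times> A" and SB: "S \<subseteq> B \<times> B"
    using R S by (auto simp: equiv_def)
  have g_class: "g (R `` {a}) = S `` {f a}" if "a \<in> A" for a
  proof -
    have "S `` {f b} = S `` {f a}" if "(a, b) \<in> R" for b
      using that \<open>a \<in> A\<close> RA S S_iff by (metis equiv_class_eq mem_Sigma_iff subsetD)
    moreover have "(a, a) \<in> R" using R that by (simp add: equiv_def refl_on_def)
    ultimately show ?thesis unfolding g_def by blast
  qed
  have onto: "B // S = g ` (A // R)"
    using f g_class by (auto simp: quotient_def)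
  have g_eq: "g (R `` {a}) = g (R `` {b}) \<longleftrightarrow> (f a, f b) \<in> S" if "a \<in> A" "b \<in> A" for a b
    using that f g_class by (metis S eq_equiv_class_iff imageI)
  have R_eq: "R `` {a} = R `` {b} \<longleftrightarrow> (a, b) \<in> R" if "a \<in> A" "b \<in> A" for a b
    using that R by (metis eq_equiv_class_iff)
  have symR: "(a, b) \<in> R \<longleftrightarrow> (b, a) \<in> R" for a b
    using R by (metis equiv_def symD)
  have transR: "(a, b) \<in> R \<Longrightarrow> (b, c) \<in> R \<Longrightarrow> (a, c) \<in> R" for a b c
    using R by (metis equiv_def transD)
  have finq: "finite (A // R)" using fin RA by (simp add: finite_quotient)
  show ?thesis
  proof (cases "(u, v) \<in> R")
    case True
    \<comment> \<open>With \<open>u\<close> and \<open>v\<close> already equivalent, the extra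
      alternatives in \<open>S_iff\<close> relate nothing new, so \<open>g\<close> is a bijection of
      the classes.\<close>
    have "inj_on g (A // R)"
    proof (rule inj_onI)
      fix C D assume "C \<in> A // R" "D \<in> A // R" and eq: "g C = g D"
      then obtain a b where ab: "a \<in> A" "b \<in> A" "C = R `` {a}" "D = R `` {b}"
        by (auto simp: quotient_def)
      have "(a, b) \<in> R"
        using eq ab g_eq S_iff True symR transR by metis
      then show "C = D" using ab R_eq by metis
    qed
    then show ?thesis using True onto by (simp add: card_image)
  next
    case False
    \<comment> \<open>Now \<open>g\<close> sends the classes of \<open>v\<close> and
      \<open>u\<close> to the same class and identifies no others; dropping \<open>?V\<close>
      restores injectivity and keeps the image.\<close>
    let ?V = "R `` {v}"
    have Vin: "?V \<in> A // R" and Uin: "R `` {u} \<in> A // R - {?V}"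
      using u v False R_eq by (auto simp: quotientI)
    have "inj_on g (A // R - {?V})"
    proof (rule inj_onI)
      fix C D assume "C \<in> A // R - {?V}" "D \<in> A // R - {?V}" and eq: "g C = g D"
      then obtain a b where ab: "a \<in> A" "b \<in> A" "C = R `` {a}" "D = R `` {b}"
        and "R `` {a} \<noteq> ?V" "R `` {b} \<noteq> ?V"
        by (blast elim: quotientE)
      then have ne: "(a, v) \<notin> R" "(b, v) \<notin> R"
        using v R_eq by metis+
      have "(a, b) \<in> R"
        using eq ab ne g_eq S_iff symR by metis
      then show "C = D" using ab R_eq by metis
    qed
    moreover have "g ?V = g (R `` {u})"
      using g_eq[OF v u] S_iff[OF v u] R u v by (auto simp: equiv_def refl_on_def)
    then have "g ` (A // R) = g ` (A // R - {?V})"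
      using Vin Uin by blast
    ultimately have "card (B // S) = card (A // R - {?V})"
      using onto by (simp add: card_image)
    then show ?thesis
      using False Vin finq card_Suc_Diff1[of "A // R" ?V] by simp
  qed
qed

section \<open>Adding an edge\<close>

text \<open>A path can be shortened until it crosses the new edge at most once, in one of its two
  directions.\<close>

lemma rtrancl_insert_sym:
  assumes "sym r"
  shows "(a, b) \<in> (r \<union> {(u, v), (v, u)})\<^sup>* \<longleftrightarrow>
    (a, b) \<in> r\<^sup>* \<or> (a, u) \<in> r\<^sup>* \<and> (v, b) \<in> r\<^sup>* \<or> (a, v) \<in> r\<^sup>* \<and> (u, b) \<in> r\<^sup>*"
proof -
  have sym: "(c, d) \<in> r\<^sup>* \<longleftrightarrow> (d, c) \<in> r\<^sup>*" for c d
    using sym_rtrancl[OF assms] by (metis symD)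
  have trans: "(c, d) \<in> r\<^sup>* \<Longrightarrow> (d, e) \<in> r\<^sup>* \<Longrightarrow> (c, e) \<in> r\<^sup>*" for c d e
    by (rule rtrancl_trans)
  have "r \<union> {(u, v), (v, u)} = insert (u, v) (insert (v, u) r)" by auto
  then show ?thesis
    by (simp only: rtrancl_insert Un_iff mem_Collect_eq prod.case) (meson sym trans rtrancl.rtrancl_refl)
qed

lemma adj_rel_insert_edge:
  assumes "e \<notin> F" "ends M e = {u, v}"
  shows "adj_rel (M\<lparr>edges := insert e F\<rparr>) = adj_rel (M\<lparr>edges := F\<rparr>) \<union> {(u, v), (v, u)}"
  using assms by (auto simp: adj_rel_def doubleton_eq_iff)

lemma same_component_insert_edge:
  assumes "e \<notin> F" "ends M e = {u, v}" "u \<in> verts M" "v \<in> verts M"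
  shows "same_component (M\<lparr>edges := insert e F\<rparr>) a b \<longleftrightarrow>
    (let s = same_component (M\<lparr>edges := F\<rparr>) in s a b \<or> s a u \<and> s v b \<or> s a v \<and> s u b)"
proof -
  note rtrancl_insert_sym[OF sym_adj_rel, of a b "M\<lparr>edges := F\<rparr>" u v,
      folded adj_rel_insert_edge[of e F M, OF assms(1,2)]]
  with assms(3,4) show ?thesis
    unfolding Let_def same_component_iff by simp blast
qed

lemma num_comps_insert_edge:
  assumes "e \<notin> F" "ends M e = {u, v}" "u \<in> verts M" "v \<in> verts M" "finite (verts M)"
  shows "num_comps (M\<lparr>edges := insert e F\<rparr>) +
    (if same_component (M\<lparr>edges := F\<rparr>) u v then 0 else 1) = num_comps (M\<lparr>edges := F\<rparr>)"
  unfolding num_comps_def components_eq conn_iff[symmetric]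
  using assms equiv_conn[of "M\<lparr>edges := F\<rparr>"] equiv_conn[of "M\<lparr>edges := insert e F\<rparr>"]
  by (intro card_quotient_merge[where f = id])
     (simp_all add: conn_iff same_component_insert_edge Let_def)

lemma num_comps_no_edges: "num_comps (M\<lparr>edges := {}\<rparr>) = card (verts M)"
proof -
  have "adj_rel (M\<lparr>edges := {}\<rparr>) = {}" by (simp add: adj_rel_def)
  then have "conn (M\<lparr>edges := {}\<rparr>) = Id_on (verts M)" by (auto simp: conn_def)
  then have "components (M\<lparr>edges := {}\<rparr>) = (\<lambda>v. {v}) ` verts M"
    by (auto simp: components_eq quotient_def)
  then show ?thesis by (simp add: num_comps_def card_image)
qed

text \<open>Starting from isolated vertices, each edge lowers the number of components by at most
  one. Hence the natural subtraction in \<open>nullity\<close> does not truncate.\<close>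

lemma verts_le_edges_plus_comps:
  assumes "wf_graph M" "F \<subseteq> edges M"
  shows "card (verts M) \<le> card F + num_comps (M\<lparr>edges := F\<rparr>)"
proof -
  have "finite F" using assms by (meson finite_subset wf_graph_def)
  then show ?thesis using assms(2)
  proof (induction F rule: finite_induct)
    case empty
    then show ?case by (simp add: num_comps_no_edges)
  next
    case (insert e F)
    from insert.prems obtain u v where "u \<in> verts M" "v \<in> verts M" "ends M e = {u, v}"
      using wf_graph_ends[OF assms(1)] by blast
    then have "num_comps (M\<lparr>edges := F\<rparr>) \<le> Suc (num_comps (M\<lparr>edges := insert e F\<rparr>))"
      using num_comps_insert_edge[of e F M u v] insert assms(1)
      by (auto simp: wf_graph_def split: if_splits)
    then show ?case using insert by simp
  qed
qed

lemma wf_graph_edges_update: "wf_graph M \<Longrightarrow> F \<subseteq> edges M \<Longrightarrow> wf_graph (M\<lparr>edges := F\<rparr>)"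
  by (auto simp: wf_graph_def intro: finite_subset)

section \<open>Identifying two vertices\<close>

lemma verts_identify:
  "u \<in> verts M \<Longrightarrow> u \<noteq> v \<Longrightarrow> verts (identify u v M) = verts M - {v}"
  by (auto simp: identify_def Let_def)

lemma edges_identify: "edges (identify u v M) = edges M"
  by (simp add: identify_def Let_def)

lemma identify_edges_update:
  "(identify u v M)\<lparr>edges := F\<rparr> = identify u v (M\<lparr>edges := F\<rparr>)"
  by (simp add: identify_def Let_def)

lemma wf_graph_identify: "wf_graph M \<Longrightarrow> wf_graph (identify u v M)"
proof -
  define q where "q w = (if w = v then u else w)" for w
  have "identify u v M = \<lparr>verts = q ` verts M, edges = edges M, ends = \<lambda>e. q ` ends M e\<rparr>"
    by (simp add: identify_def Let_def q_def)
  moreover have "\<exists>c\<in>q ` verts M. \<exists>d\<in>q ` verts M. q ` ends M e = {c, d}"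
    if wf: "wf_graph M" and e: "e \<in> edges M" for e
  proof -
    obtain c d where "c \<in> verts M" "d \<in> verts M" "ends M e = {c, d}"
      using wf e by (rule wf_graph_ends)
    then show ?thesis by (intro bexI[of _ "q c"] bexI[of _ "q d"]) auto
  qed
  ultimately show "wf_graph M \<Longrightarrow> wf_graph (identify u v M)"
    by (simp add: wf_graph_def)
qed

text \<open>\<open>wf_graph\<close> limits each edge to two ends; a set of three ends could shrink
  to a pair under the quotient map and create an adjacency without a preimage.\<close>

lemma adj_rel_identify:
  assumes "wf_graph M"
  shows "adj_rel (identify u v M) =
    map_prod (\<lambda>w. if w = v then u else w) (\<lambda>w. if w = v then u else w) ` adj_rel M"
    (is "_ = map_prod ?q ?q ` _")
proof -
  have fwd: "(s, t) \<in> map_prod ?q ?q ` adj_rel M"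
    if e: "e \<in> edges M" "?q ` ends M e = {s, t}" for s t e
  proof -
    obtain c d where cd: "ends M e = {c, d}" using assms e(1) by (rule wf_graph_ends)
    have "{?q c, ?q d} = {s, t}" using e(2) unfolding cd by (simp only: image_insert image_empty)
    then have "(s, t) = map_prod ?q ?q (c, d) \<or> (s, t) = map_prod ?q ?q (d, c)"
      unfolding doubleton_eq_iff map_prod_simp by blast
    moreover have "(c, d) \<in> adj_rel M" "(d, c) \<in> adj_rel M"
      using cd e(1) by (auto simp: adj_rel_def insert_commute)
    ultimately show ?thesis by blast
  qed
  have bwd: "\<exists>e\<in>edges M. ?q ` ends M e = {?q c, ?q d}" if cd: "(c, d) \<in> adj_rel M" for c d
  proof -
    obtain e where "e \<in> edges M" "ends M e = {c, d}" using cd by (auto simp: adj_rel_def)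
    then have "?q ` ends M e = {?q c, ?q d}" by (simp only: image_insert image_empty)
    with \<open>e \<in> edges M\<close> show ?thesis by blast
  qed
  have "(s, t) \<in> adj_rel (identify u v M) \<longleftrightarrow> (\<exists>e\<in>edges M. ?q ` ends M e = {s, t})" for s t
    unfolding adj_rel_def identify_def Let_def by simp
  then show ?thesis using fwd bwd by (auto simp only: map_prod_simp)
qed

text \<open>For reachability, identifying \<open>u\<close> and \<open>v\<close> amounts to joining
  them by an edge, because \<open>q\<close> identifies no other pair of distinct vertices. This
  makes \<open>rtrancl_insert_sym\<close> applicable.\<close>

lemma rtrancl_identify:
  fixes u v :: 'v
  assumes "wf_graph M"
  defines "q \<equiv> \<lambda>w. if w = v then u else w"
  shows "(q a, q b) \<in> (adj_rel (identify u v M))\<^sup>* \<longleftrightarrow>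
    (a, b) \<in> (adj_rel M \<union> {(u, v), (v, u)})\<^sup>*" (is "_ \<in> ?S\<^sup>* \<longleftrightarrow> _ \<in> ?R\<^sup>*")
proof
  have adj: "?S = map_prod q q ` adj_rel M"
    unfolding q_def by (rule adj_rel_identify[OF assms(1)])
  have q_eq: "(c, d) \<in> ?R\<^sup>*" if "q c = q d" for c d
  proof -
    have "c = d \<or> (c, d) \<in> ?R" using that by (auto simp: q_def split: if_splits)
    then show ?thesis by auto
  qed
  \<comment> \<open>All preimages of \<open>t\<close> are covered, because the next edge may leave
    from a preimage other than the one just reached.\<close>
  have "\<forall>b. t = q b \<longrightarrow> (a, b) \<in> ?R\<^sup>*" if "(q a, t) \<in> ?S\<^sup>*" for t
    using that
  proof (induction rule: rtrancl_induct)
    case base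
    then show ?case using q_eq by blast
  next
    case (step s t)
    then obtain c d where cd: "s = q c" "t = q d" "(c, d) \<in> adj_rel M"
      by (auto simp: adj)
    have "(a, c) \<in> ?R\<^sup>*" using step.IH cd(1) by blast
    moreover have "(c, d) \<in> ?R" using cd(3) by blast
    ultimately have "(a, d) \<in> ?R\<^sup>*" by (rule rtrancl_into_rtrancl)
    then show ?case using cd(2) q_eq by (meson rtrancl_trans)
  qed
  then show "(q a, q b) \<in> ?S\<^sup>* \<Longrightarrow> (a, b) \<in> ?R\<^sup>*" by blast
  have edge: "(q c, q d) \<in> ?S\<^sup>*" if cd: "(c, d) \<in> ?R" for c d
  proof -
    consider "(c, d) \<in> adj_rel M" | "(c, d) \<in> {(u, v), (v, u)}" using cd by blast
    then have "q c = q d \<or> (q c, q d) \<in> ?S"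
    proof cases
      case 1
      then have "map_prod q q (c, d) \<in> ?S" unfolding adj by (rule imageI)
      then show ?thesis by simp
    qed (auto simp: q_def)
    then show ?thesis by auto
  qed
  show "(q a, q b) \<in> ?S\<^sup>*" if "(a, b) \<in> ?R\<^sup>*"
    using that
  proof (induction rule: rtrancl_induct)
    case (step c d)
    from step.IH edge[OF step.hyps(2)]
    show ?case by (rule rtrancl_trans)
  qed simp
qed

text \<open>Phrased through images under the quotient map, so that \<open>v\<close> itself is
  covered; this is the form \<open>card_quotient_merge\<close> asks for.\<close>

lemma same_component_identify_image:
  assumes "wf_graph M" "u \<in> verts M" "v \<in> verts M" "u \<noteq> v" "a \<in> verts M" "b \<in> verts M"
  shows "same_component (identify u v M) (if a = v then u else a) (if b = v then u else b) \<longleftrightarrow>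
    (let s = same_component M in s a b \<or> s a u \<and> s v b \<or> s a v \<and> s u b)"
proof -
  let ?q = "\<lambda>w. if w = v then u else w"
  have "?q a \<in> verts (identify u v M)" "?q b \<in> verts (identify u v M)"
    using assms by (simp_all add: verts_identify)
  then show ?thesis
    unfolding Let_def same_component_iff rtrancl_identify[OF assms(1)]
      rtrancl_insert_sym[OF sym_adj_rel]
    using assms(2-) by blast
qed

lemma same_component_identify:
  assumes "wf_graph M" "u \<in> verts M" "v \<in> verts M" "u \<noteq> v"
    and "a \<in> verts M" "b \<in> verts M" "a \<noteq> v" "b \<noteq> v"
  shows "same_component (identify u v M) a b \<longleftrightarrow>
    (let s = same_component M in s a b \<or> s a u \<and> s v b \<or> s a v \<and> s u b)"
  using same_component_identify_image[OF assms(1-6)] assms(7,8) by simp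

lemma num_comps_identify:
  assumes "wf_graph M" "u \<in> verts M" "v \<in> verts M" "u \<noteq> v"
  shows "num_comps (identify u v M) + (if same_component M u v then 0 else 1) = num_comps M"
  unfolding num_comps_def components_eq conn_iff[symmetric]
proof (intro card_quotient_merge[where f = "\<lambda>w. if w = v then u else w"] equiv_conn)
  show "(\<lambda>w. if w = v then u else w) ` verts M = verts (identify u v M)"
    by (simp add: identify_def Let_def)
  show "finite (verts M)" using assms by (simp add: wf_graph_def)
  fix a b assume "a \<in> verts M" "b \<in> verts M"
  then show "(if a = v then u else a, if b = v then u else b) \<in> conn (identify u v M) \<longleftrightarrow>
    (a, b) \<in> conn M \<or> (a, u) \<in> conn M \<and> (v, b) \<in> conn M \<or> (a, v) \<in> conn M \<and> (u, b) \<in> conn M"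
    unfolding conn_iff using same_component_identify_image[OF assms] by (simp add: Let_def)
qed (use assms in auto)

lemma adj_rel_add_edge_absent:
  "e \<notin> F \<Longrightarrow> adj_rel ((add_edge e u v M)\<lparr>edges := F\<rparr>) = adj_rel (M\<lparr>edges := F\<rparr>)"
  by (auto simp: adj_rel_def add_edge_def)

subsection \<open>Four copies and their gluing\<close>

text \<open>The subgraph \<open>H\<^sub>i\<close> of the idea above: what \<open>E\<close> selects
  in the \<open>i\<close>-th copy, moved back to \<open>K\<close>.\<close>

definition part :: "graph \<Rightarrow> ename set \<Rightarrow> nat \<Rightarrow> graph" where
  "part K E i = K\<lparr>edges := ECopy i -` E\<rparr>"

lemma verts_four_copies: "verts (four_copies K) = (\<Union>i\<in>{1..4}. VCopy i ` verts K)"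
  and edges_four_copies: "edges (four_copies K) = (\<Union>i\<in>{1..4}. ECopy i ` edges K)"
  by (simp_all add: four_copies_def)

lemma ends_four_copies: "ends (four_copies K) (ECopy i e) = VCopy i ` ends K e"
  by (simp add: four_copies_def)

lemma wf_graph_four_copies:
  assumes "wf_graph K"
  shows "wf_graph (four_copies K)"
  unfolding wf_graph_def
proof (intro conjI ballI)
  show "finite (verts (four_copies K))" "finite (edges (four_copies K))"
    using assms by (auto simp: wf_graph_def verts_four_copies edges_four_copies)
  fix e assume "e \<in> edges (four_copies K)"
  then obtain i e' where e: "i \<in> {1..4}" "e' \<in> edges K" "e = ECopy i e'"
    by (auto simp: edges_four_copies)
  obtain c d where "c \<in> verts K" "d \<in> verts K" "ends K e' = {c, d}"
    using assms e(2) by (rule wf_graph_ends)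
  then have "VCopy i c \<in> verts (four_copies K)" "VCopy i d \<in> verts (four_copies K)"
    "ends (four_copies K) e = {VCopy i c, VCopy i d}"
    using e unfolding verts_four_copies by (blast, blast, simp add: four_copies_def)
  then show "\<exists>c\<in>verts (four_copies K). \<exists>d\<in>verts (four_copies K). ends (four_copies K) e = {c, d}"
    by blast
qed

lemma VCopy_image_eq_doubleton:
  "VCopy i ` A = {s, t} \<longleftrightarrow> (\<exists>a b. s = VCopy i a \<and> t = VCopy i b \<and> A = {a, b})"
proof
  assume *: "VCopy i ` A = {s, t}"
  then obtain a b where ab: "s = VCopy i a" "t = VCopy i b" by blast
  then have "VCopy i ` A = VCopy i ` {a, b}" using * by simp
  then have "A = {a, b}" by (subst (asm) inj_image_eq_iff) (auto simp: inj_def)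
  with ab show "\<exists>a b. s = VCopy i a \<and> t = VCopy i b \<and> A = {a, b}" by blast
qed auto

context
  fixes K :: graph and E :: "ename set"
  assumes E: "E \<subseteq> edges (four_copies K)"
begin

lemma adj_rel_four_copies:
  "(s, t) \<in> adj_rel ((four_copies K)\<lparr>edges := E\<rparr>) \<longleftrightarrow>
    (\<exists>i a b. s = VCopy i a \<and> t = VCopy i b \<and> (a, b) \<in> adj_rel (part K E i))"
proof -
  have "(\<exists>e\<in>E. ends (four_copies K) e = {s, t}) \<longleftrightarrow>
    (\<exists>i a b. s = VCopy i a \<and> t = VCopy i b \<and> (\<exists>e. ECopy i e \<in> E \<and> ends K e = {a, b}))" for s t
  proof -
    have "(\<exists>e\<in>E. ends (four_copies K) e = {s, t}) \<longleftrightarrow>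
      (\<exists>i e. ECopy i e \<in> E \<and> VCopy i ` ends K e = {s, t})"
    proof
      assume "\<exists>e\<in>E. ends (four_copies K) e = {s, t}"
      then obtain e where e: "e \<in> E" "ends (four_copies K) e = {s, t}" by blast
      moreover obtain i e' where "e = ECopy i e'" using e(1) E by (auto simp: edges_four_copies)
      ultimately show "\<exists>i e. ECopy i e \<in> E \<and> VCopy i ` ends K e = {s, t}"
        by (metis ends_four_copies)
    qed (metis ends_four_copies)
    then show ?thesis unfolding VCopy_image_eq_doubleton by blast
  qed
  then show ?thesis by (simp add: adj_rel_def part_def Bex_def)
qed

text \<open>Adjacency never leaves a copy, so the index \<open>i\<close> is invariant along a
  path.\<close>

lemma rtrancl_four_copies:
  "(VCopy i a, VCopy j b) \<in> (adj_rel ((four_copies K)\<lparr>edges := E\<rparr>))\<^sup>* \<longleftrightarrow>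
    i = j \<and> (a, b) \<in> (adj_rel (part K E i))\<^sup>*" (is "_ \<in> ?R\<^sup>* \<longleftrightarrow> _")
proof
  have "\<exists>c. t = VCopy i c \<and> (a, c) \<in> (adj_rel (part K E i))\<^sup>*" if "(VCopy i a, t) \<in> ?R\<^sup>*" for t
    using that
    by (induction rule: rtrancl_induct)
      (auto simp: adj_rel_four_copies intro: rtrancl.rtrancl_into_rtrancl)
  then show "(VCopy i a, VCopy j b) \<in> ?R\<^sup>* \<Longrightarrow> i = j \<and> (a, b) \<in> (adj_rel (part K E i))\<^sup>*"
    by blast
  have "(VCopy i a, VCopy i b) \<in> ?R\<^sup>*" if "(a, b) \<in> (adj_rel (part K E i))\<^sup>*"
    using that
    by (induction rule: rtrancl_induct)
      (auto simp: adj_rel_four_copies intro: rtrancl.rtrancl_into_rtrancl)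
  then show "i = j \<and> (a, b) \<in> (adj_rel (part K E i))\<^sup>* \<Longrightarrow> (VCopy i a, VCopy j b) \<in> ?R\<^sup>*"
    by blast
qed

lemma same_component_four_copies:
  "same_component ((four_copies K)\<lparr>edges := E\<rparr>) (VCopy i a) (VCopy j b) \<longleftrightarrow>
    i = j \<and> i \<in> {1..4} \<and> same_component (part K E i) a b"
  unfolding same_component_iff rtrancl_four_copies
  by (auto simp: verts_four_copies part_def)

lemma components_four_copies:
  "components ((four_copies K)\<lparr>edges := E\<rparr>) = (\<Union>i\<in>{1..4}. (`) (VCopy i) ` components (part K E i))"
proof -
  let ?D = "(four_copies K)\<lparr>edges := E\<rparr>"
  have class_eq: "conn ?D `` {VCopy i a} = VCopy i ` (conn (part K E i) `` {a})" if "i \<in> {1..4}" for i a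
  proof -
    have "t \<in> conn ?D `` {VCopy i a} \<longleftrightarrow> (\<exists>b. t = VCopy i b \<and> (a, b) \<in> conn (part K E i))" for t
      using that
      by (cases t) (auto simp: conn_iff same_component_four_copies,
        auto simp: same_component_iff verts_four_copies)
    then show ?thesis by blast
  qed
  have "components ?D = (\<Union>i\<in>{1..4}. (\<lambda>a. conn ?D `` {VCopy i a}) ` verts K)"
    unfolding components_eq quotient_def by (auto simp: verts_four_copies)
  also have "\<dots> = (\<Union>i\<in>{1..4}. (\<lambda>a. VCopy i ` (conn (part K E i) `` {a})) ` verts K)"
    using class_eq by (intro SUP_cong image_cong) simp_all
  also have "\<dots> = (\<Union>i\<in>{1..4}. (`) (VCopy i) ` components (part K E i))"
    unfolding components_eq quotient_def by (auto simp: part_def)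
  finally show ?thesis .
qed

lemma num_comps_four_copies:
  assumes "finite (verts K)"
  shows "num_comps ((four_copies K)\<lparr>edges := E\<rparr>) = (\<Sum>i\<in>{1..4}. num_comps (part K E i))"
proof -
  have fin: "finite (components (part K E i))" for i
    using assms by (intro finite_components) (simp add: part_def)
  \<comment> \<open>Nonemptiness is what makes the families of different copies disjoint: an empty
    component would have the same image in every copy.\<close>
  have ne: "C \<noteq> {}" if "C \<in> components (part K E i)" for C i
    using that in_quotient_imp_non_empty[OF equiv_conn] by (simp add: components_eq)
  have "card (\<Union>i\<in>{1..4}. (`) (VCopy i) ` components (part K E i)) =
    (\<Sum>i\<in>{1..4}. card ((`) (VCopy i) ` components (part K E i)))"
    using fin ne by (intro card_UN_disjoint) (auto, blast)
  also have "\<dots> = (\<Sum>i\<in>{1..4}. card (components (part K E i)))"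
    by (intro sum.cong refl card_image inj_onI) (auto simp: inj_image_eq_iff inj_def)
  finally show ?thesis by (simp add: num_comps_def components_four_copies)
qed

end

text \<open>The copies become the sides of a 4-cycle whose corners are \<open>VCopy 1 p\<close> (the
  new X), \<open>VCopy 1 q\<close> (the vertex a), \<open>VCopy 3 q\<close> (the new Y) and
  \<open>VCopy 2 q\<close> (the vertex b). Copies 1 and 3 form one path from X to Y, copies 2 and 4
  the other.\<close>

definition glue :: "vname \<Rightarrow> vname \<Rightarrow> graph \<Rightarrow> graph" where
  "glue p q M = identify (VCopy 2 q) (VCopy 4 p) (identify (VCopy 1 q) (VCopy 3 p)
    (identify (VCopy 3 q) (VCopy 4 q) (identify (VCopy 1 p) (VCopy 2 p) M)))"

lemma G_Suc: "G (Suc n) =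
  add_edge ENew (VCopy 1 (Y n)) (VCopy 2 (Y n)) (glue (X n) (Y n) (four_copies (G n)))"
  by (simp add: Let_def glue_def)

text \<open>Two corners of the 4-cycle are connected iff all copies along one of the two arcs
  between them connect their terminals. All pairs of corners are listed except X with Y counted
  twice in reverse order.\<close>

lemma
  assumes "wf_graph K" and p: "p \<in> verts K" and q: "q \<in> verts K" and "p \<noteq> q"
    and E: "E \<subseteq> edges (four_copies K)"
  defines "D \<equiv> glue p q ((four_copies K)\<lparr>edges := E\<rparr>)"
    and "c \<equiv> \<lambda>i. same_component (part K E i) p q"
  shows wf_graph_glue: "wf_graph D"
    and verts_glue: "verts D = verts (four_copies K) - {VCopy 2 p, VCopy 4 q, VCopy 3 p, VCopy 4 p}"
    and num_comps_glue: "num_comps D + (if c 1 \<and> c 2 \<and> c 3 \<and> c 4 then 3 else 4) =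
      (\<Sum>i\<in>{1..4}. num_comps (part K E i))"
    and same_component_glue:
      "same_component D (VCopy 1 p) (VCopy 3 q) \<longleftrightarrow> c 1 \<and> c 3 \<or> c 2 \<and> c 4"
      "same_component D (VCopy 1 q) (VCopy 2 q) \<longleftrightarrow> c 1 \<and> c 2 \<or> c 3 \<and> c 4"
      "same_component D (VCopy 1 p) (VCopy 1 q) \<longleftrightarrow> c 1 \<or> c 2 \<and> c 3 \<and> c 4"
      "same_component D (VCopy 1 p) (VCopy 2 q) \<longleftrightarrow> c 2 \<or> c 1 \<and> c 3 \<and> c 4"
      "same_component D (VCopy 1 q) (VCopy 3 q) \<longleftrightarrow> c 3 \<or> c 1 \<and> c 2 \<and> c 4"
      "same_component D (VCopy 2 q) (VCopy 3 q) \<longleftrightarrow> c 4 \<or> c 1 \<and> c 2 \<and> c 3"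
proof -
  define D0 where "D0 = (four_copies K)\<lparr>edges := E\<rparr>"
  define D1 where "D1 = identify (VCopy 1 p) (VCopy 2 p) D0"
  define D2 where "D2 = identify (VCopy 3 q) (VCopy 4 q) D1"
  define D3 where "D3 = identify (VCopy 1 q) (VCopy 3 p) D2"
  have D: "D = identify (VCopy 2 q) (VCopy 4 p) D3"
    by (simp add: D_def glue_def D0_def D1_def D2_def D3_def)
  have wf0: "wf_graph D0"
    using E wf_graph_four_copies[OF assms(1)] by (simp add: D0_def wf_graph_edges_update)
  then have wf: "wf_graph D1" "wf_graph D2" "wf_graph D3" "wf_graph D"
    by (simp_all add: D D1_def D2_def D3_def wf_graph_identify)
  note wf = wf0 wf
  have mem0: "VCopy i w \<in> verts D0 \<longleftrightarrow> i \<in> {1..4} \<and> w \<in> verts K" for i w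
    by (auto simp: D0_def verts_four_copies)
  have v1: "verts D1 = verts D0 - {VCopy 2 p}"
    unfolding D1_def using mem0 p by (intro verts_identify) auto
  have v2: "verts D2 = verts D1 - {VCopy 4 q}"
    unfolding D2_def using mem0 v1 q by (intro verts_identify) auto
  have v3: "verts D3 = verts D2 - {VCopy 3 p}"
    unfolding D3_def using mem0 v1 v2 q by (intro verts_identify) auto
  have v4: "verts D = verts D3 - {VCopy 4 p}"
    unfolding D using mem0 v1 v2 v3 q \<open>p \<noteq> q\<close> by (intro verts_identify) auto
  note v = v1 v2 v3 v4 mem0
  note ne = p q \<open>p \<noteq> q\<close> \<open>p \<noteq> q\<close>[symmetric]
  have c_iff: "same_component (part K E i) p q = c i" "same_component (part K E i) q p = c i" for i
    by (simp_all add: c_def same_component_sym)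
  have refl: "same_component (part K E i) w w" if "w \<in> verts K" for i w
    using that by (simp add: same_component_refl part_def)
  have s0: "same_component D0 (VCopy i a) (VCopy j b) \<longleftrightarrow>
    i = j \<and> i \<in> {1..4} \<and> same_component (part K E i) a b" for i j a b
    unfolding D0_def by (rule same_component_four_copies[OF E])
  \<comment> \<open>Each of \<open>s1\<close> to \<open>s4\<close> reduces connectivity after one
    identification to the graph before it, for vertices whose names survive. Rewriting ends in
    \<open>s0\<close>, where only the \<open>c i\<close> remain.\<close>
  have s1: "same_component D1 a b \<longleftrightarrow> (let s = same_component D0 in
      s a b \<or> s a (VCopy 1 p) \<and> s (VCopy 2 p) b \<or> s a (VCopy 2 p) \<and> s (VCopy 1 p) b)"
    if "a \<in> verts D1" "b \<in> verts D1" for a b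
    unfolding D1_def using that wf ne by (intro same_component_identify) (auto simp: v)
  have s2: "same_component D2 a b \<longleftrightarrow> (let s = same_component D1 in
      s a b \<or> s a (VCopy 3 q) \<and> s (VCopy 4 q) b \<or> s a (VCopy 4 q) \<and> s (VCopy 3 q) b)"
    if "a \<in> verts D2" "b \<in> verts D2" for a b
    unfolding D2_def using that wf ne by (intro same_component_identify) (auto simp: v)
  have s3: "same_component D3 a b \<longleftrightarrow> (let s = same_component D2 in
      s a b \<or> s a (VCopy 1 q) \<and> s (VCopy 3 p) b \<or> s a (VCopy 3 p) \<and> s (VCopy 1 q) b)"
    if "a \<in> verts D3" "b \<in> verts D3" for a b
    unfolding D3_def using that wf ne by (intro same_component_identify) (auto simp: v)
  have s4: "same_component D a b \<longleftrightarrow> (let s = same_component D3 in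
      s a b \<or> s a (VCopy 2 q) \<and> s (VCopy 4 p) b \<or> s a (VCopy 4 p) \<and> s (VCopy 2 q) b)"
    if "a \<in> verts D" "b \<in> verts D" for a b
    unfolding D using that wf ne by (intro same_component_identify) (auto simp: v)
  note s_simps = s0 c_iff refl v ne Let_def
  show "wf_graph D" by (rule wf)
  show "verts D = verts (four_copies K) - {VCopy 2 p, VCopy 4 q, VCopy 3 p, VCopy 4 p}"
    by (auto simp: v1 v2 v3 v4 D0_def)
  show "same_component D (VCopy 1 p) (VCopy 3 q) \<longleftrightarrow> c 1 \<and> c 3 \<or> c 2 \<and> c 4"
    "same_component D (VCopy 1 q) (VCopy 2 q) \<longleftrightarrow> c 1 \<and> c 2 \<or> c 3 \<and> c 4"
    "same_component D (VCopy 1 p) (VCopy 1 q) \<longleftrightarrow> c 1 \<or> c 2 \<and> c 3 \<and> c 4"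
    "same_component D (VCopy 1 p) (VCopy 2 q) \<longleftrightarrow> c 2 \<or> c 1 \<and> c 3 \<and> c 4"
    "same_component D (VCopy 1 q) (VCopy 3 q) \<longleftrightarrow> c 3 \<or> c 1 \<and> c 2 \<and> c 4"
    "same_component D (VCopy 2 q) (VCopy 3 q) \<longleftrightarrow> c 4 \<or> c 1 \<and> c 2 \<and> c 3"
    by - (auto simp: s4 s3 s2 s1 s_simps)
  \<comment> \<open>The first three identifications always merge: copy 1 with 2, copy 3 with 4, then
    the first pair with the second, none of them attached to each other before.\<close>
  have "num_comps D1 + 1 = num_comps D0"
    using num_comps_identify[of D0 "VCopy 1 p" "VCopy 2 p"] wf by (simp add: D1_def s_simps)
  moreover have "num_comps D2 + 1 = num_comps D1"
    using num_comps_identify[of D1 "VCopy 3 q" "VCopy 4 q"] wf by (simp add: D2_def s1 s_simps)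
  moreover have "num_comps D3 + 1 = num_comps D2"
    using num_comps_identify[of D2 "VCopy 1 q" "VCopy 3 p"] wf by (simp add: D3_def s2 s1 s_simps)
  \<comment> \<open>The last identification closes the cycle; its two vertices are already connected
    iff all four copies are traversable.\<close>
  moreover have "num_comps D + (if c 1 \<and> c 2 \<and> c 3 \<and> c 4 then 0 else 1) = num_comps D3"
    using num_comps_identify[of D3 "VCopy 2 q" "VCopy 4 p"] wf
    by (simp add: D s3 s2 s1 s_simps conj_ac split: if_splits)
  moreover have "num_comps D0 = (\<Sum>i\<in>{1..4}. num_comps (part K E i))"
    unfolding D0_def using assms(1) by (intro num_comps_four_copies[OF E]) (simp add: wf_graph_def)
  ultimately show "num_comps D + (if c 1 \<and> c 2 \<and> c 3 \<and> c 4 then 3 else 4) =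
      (\<Sum>i\<in>{1..4}. num_comps (part K E i))"
    by (simp split: if_splits)
qed

subsection \<open>The graphs \<open>G\<^sub>n\<close>\<close>

text \<open>Thus a spanning subgraph of the glued graph is the gluing of a spanning subgraph of the
  four copies.\<close>

lemma glue_edges_update: "(glue p q M)\<lparr>edges := F\<rparr> = glue p q (M\<lparr>edges := F\<rparr>)"
  by (simp add: glue_def identify_edges_update)

declare G.simps(2) [simp del]

lemma edges_glue: "edges (glue p q M) = edges M"
  by (simp add: glue_def edges_identify)

lemma verts_add_edge: "verts (add_edge e u v M) = verts M"
  and edges_add_edge: "edges (add_edge e u v M) = insert e (edges M)"
  and ends_add_edge: "ends (add_edge e u v M) e = {u, v}"
  by (simp_all add: add_edge_def)

lemma wf_graph_add_edge:
  "wf_graph M \<Longrightarrow> u \<in> verts M \<Longrightarrow> v \<in> verts M \<Longrightarrow> wf_graph (add_edge e u v M)"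
  by (simp add: wf_graph_def add_edge_def) blast

lemma edges_update_id: "M\<lparr>edges := edges M\<rparr> = M"
  by (cases M) simp

lemma VCopy_mem_four_copies: "VCopy i w \<in> verts (four_copies K) \<longleftrightarrow> i \<in> {1..4} \<and> w \<in> verts K"
  by (auto simp: verts_four_copies)

text \<open>One joint induction, since the gluing lemmas need all four facts about
  \<open>G n\<close>.\<close>

lemma wf_G_terminals: "wf_graph (G n) \<and> X n \<in> verts (G n) \<and> Y n \<in> verts (G n) \<and> X n \<noteq> Y n"
proof (induction n)
  case 0
  show ?case by (auto simp: K2_def wf_graph_def)
next
  case (Suc n)
  let ?D = "glue (X n) (Y n) (four_copies (G n))"
  have "wf_graph ?D" and v: "verts ?D = verts (four_copies (G n)) -
      {VCopy 2 (X n), VCopy 4 (Y n), VCopy 3 (X n), VCopy 4 (X n)}"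
    using wf_graph_glue[of "G n" "X n" "Y n" "edges (four_copies (G n))"]
      verts_glue[of "G n" "X n" "Y n" "edges (four_copies (G n))"] Suc
    by (simp_all add: edges_update_id)
  moreover have mem: "VCopy 1 (X n) \<in> verts ?D" "VCopy 1 (Y n) \<in> verts ?D"
    "VCopy 2 (Y n) \<in> verts ?D" "VCopy 3 (Y n) \<in> verts ?D"
    unfolding v using Suc Suc[THEN conjunct2, THEN conjunct2, THEN conjunct2, symmetric]
    by (simp_all add: VCopy_mem_four_copies)
  ultimately have "wf_graph (G (Suc n))"
    unfolding G_Suc by (intro wf_graph_add_edge)
  then show ?case
    using mem by (simp add: G_Suc verts_add_edge)
qed

lemmas wf_G = wf_G_terminals[THEN conjunct1]
  and X_in_G = wf_G_terminals[THEN conjunct2, THEN conjunct1]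
  and Y_in_G = wf_G_terminals[THEN conjunct2, THEN conjunct2, THEN conjunct1]
  and X_neq_Y = wf_G_terminals[THEN conjunct2, THEN conjunct2, THEN conjunct2]

lemma finite_verts_G: "finite (verts (G n))"
  using wf_G by (simp add: wf_graph_def)

lemma finite_edges_G: "finite (edges (G n))"
  using wf_G by (simp add: wf_graph_def)

lemma edges_G_Suc: "edges (G (Suc n)) = insert ENew (\<Union>i\<in>{1..4}. ECopy i ` edges (G n))"
  by (simp add: G_Suc edges_add_edge edges_glue edges_four_copies)

lemma verts_G_Suc: "verts (G (Suc n)) = verts (four_copies (G n)) -
    {VCopy 2 (X n), VCopy 4 (Y n), VCopy 3 (X n), VCopy 4 (X n)}"
  using verts_glue[OF wf_G X_in_G Y_in_G X_neq_Y order_refl]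
  by (simp add: G_Suc verts_add_edge edges_update_id)

text \<open>Each identification drops one vertex name, and the four dropped names are distinct
  because \<open>X n\<close> and \<open>Y n\<close> are.\<close>

lemma card_verts_G_Suc: "card (verts (G (Suc n))) + 4 = 4 * card (verts (G n))"
proof -
  let ?S = "{VCopy 2 (X n), VCopy 4 (Y n), VCopy 3 (X n), VCopy 4 (X n)}"
  have "card (verts (four_copies (G n))) = (\<Sum>i\<in>{1..4::nat}. card (VCopy i ` verts (G n)))"
    unfolding verts_four_copies using finite_verts_G by (intro card_UN_disjoint) auto
  also have "\<dots> = 4 * card (verts (G n))"
    by (simp add: card_image inj_on_def)
  finally have 1: "card (verts (four_copies (G n))) = 4 * card (verts (G n))" .
  have 2: "?S \<subseteq> verts (four_copies (G n))"
    using X_in_G Y_in_G by (simp add: VCopy_mem_four_copies)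
  have 3: "card ?S = 4" using X_neq_Y[of n] by simp
  have "card ?S \<le> card (verts (four_copies (G n)))"
    using 2 finite_verts_G by (intro card_mono) (simp_all add: verts_four_copies)
  then show ?thesis
    unfolding verts_G_Suc using 1 2 3 by (simp add: card_Diff_subset)
qed

text \<open>
  In the following two definitions \<open>d\<close> tells whether the new edge is present, and \<open>c\<^sub>i\<close> whether the
  terminals of the \<open>i\<close>-th copy are connected. Three of the four identifications always merge
  components; the fourth closes the cycle of copies.
\<close>

definition joined :: "bool \<Rightarrow> bool \<Rightarrow> bool \<Rightarrow> bool \<Rightarrow> bool \<Rightarrow> bool" where
  "joined d c1 c2 c3 c4 \<longleftrightarrow> c1 \<and> c3 \<or> c2 \<and> c4 \<or> d \<and> (c1 \<or> c2) \<and> (c3 \<or> c4)"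

definition merges :: "bool \<Rightarrow> bool \<Rightarrow> bool \<Rightarrow> bool \<Rightarrow> bool \<Rightarrow> nat" where
  "merges d c1 c2 c3 c4 = (if c1 \<and> c2 \<and> c3 \<and> c4 then 3 else 4) +
    (if d \<and> \<not> (c1 \<and> c2 \<or> c3 \<and> c4) then 1 else 0)"

definition linked :: "nat \<Rightarrow> ename set \<Rightarrow> bool" where
  "linked n E \<longleftrightarrow> same_component ((G n)\<lparr>edges := E\<rparr>) (X n) (Y n)"

abbreviation comps :: "nat \<Rightarrow> ename set \<Rightarrow> nat" where
  "comps n E \<equiv> num_comps ((G n)\<lparr>edges := E\<rparr>)"

text \<open>The subgraph is glued without the new edge first; the edge ab, if present, is then added
  to the result.\<close>

lemma
  assumes E: "E \<subseteq> edges (G (Suc n))"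
  defines "c \<equiv> \<lambda>i. linked n (ECopy i -` E)"
  shows comps_Suc: "comps (Suc n) E + merges (ENew \<in> E) (c 1) (c 2) (c 3) (c 4) =
      (\<Sum>i\<in>{1..4}. comps n (ECopy i -` E))"
    and linked_Suc: "linked (Suc n) E \<longleftrightarrow> joined (ENew \<in> E) (c 1) (c 2) (c 3) (c 4)"
proof -
  define E' where "E' = E - {ENew}"
  have E': "E' \<subseteq> edges (four_copies (G n))"
    using E unfolding E'_def edges_G_Suc edges_four_copies by blast
  define M where "M = (G (Suc n))\<lparr>edges := E'\<rparr>"
  define D where "D = glue (X n) (Y n) ((four_copies (G n))\<lparr>edges := E'\<rparr>)"
  have part: "part (G n) E' i = (G n)\<lparr>edges := ECopy i -` E\<rparr>" for i
  proof -
    have "ECopy i -` E' = ECopy i -` E" by (auto simp: E'_def)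
    then show ?thesis by (simp add: part_def)
  qed
  note DG = wf_G[of n] X_in_G[of n] Y_in_G[of n] X_neq_Y[of n] E'
  have verts: "verts M = verts D"
    using verts_glue[OF DG] by (simp add: M_def D_def verts_G_Suc)
  \<comment> \<open>\<open>M\<close> and \<open>D\<close> are different records:
    \<open>add_edge\<close> changed \<open>ends\<close> at \<open>ENew\<close>. Adjacency does not
    see this, as \<open>ENew\<close> is absent from \<open>E'\<close>.\<close>
  have adj: "adj_rel M = adj_rel D"
    unfolding M_def D_def G_Suc
    by (subst adj_rel_add_edge_absent) (simp_all add: E'_def glue_edges_update)
  have num: "num_comps M + (if c 1 \<and> c 2 \<and> c 3 \<and> c 4 then 3 else 4) =
      (\<Sum>i\<in>{1..4}. comps n (ECopy i -` E))"
    unfolding num_comps_cong[OF verts adj] D_def c_def linked_def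
    using num_comps_glue[OF DG] by (simp add: part)
  note same = same_component_glue[OF DG, folded D_def, folded same_component_cong[OF verts adj],
    unfolded part, folded linked_def]
  have ends: "ends (G (Suc n)) ENew = {VCopy 1 (Y n), VCopy 2 (Y n)}"
    by (simp add: G_Suc ends_add_edge)
  have mem: "VCopy 1 (X n) \<in> verts (G (Suc n))" "VCopy 1 (Y n) \<in> verts (G (Suc n))"
    "VCopy 2 (Y n) \<in> verts (G (Suc n))" "VCopy 3 (Y n) \<in> verts (G (Suc n))"
    using DG by (auto simp: verts_G_Suc VCopy_mem_four_copies)
  have notin: "ENew \<notin> E'" by (simp add: E'_def)
  have "comps (Suc n) E + merges (ENew \<in> E) (c 1) (c 2) (c 3) (c 4) =
      num_comps M + (if c 1 \<and> c 2 \<and> c 3 \<and> c 4 then 3 else 4) \<and>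
    (linked (Suc n) E \<longleftrightarrow> joined (ENew \<in> E) (c 1) (c 2) (c 3) (c 4))"
  proof (cases "ENew \<in> E")
    case True
    then have ins: "E = insert ENew E'" by (auto simp: E'_def)
    have 1: "comps (Suc n) E + (if same_component M (VCopy 1 (Y n)) (VCopy 2 (Y n)) then 0 else 1) =
        num_comps M"
      unfolding ins M_def
      by (rule num_comps_insert_edge[OF notin ends mem(2,3) finite_verts_G])
    have 2: "linked (Suc n) E \<longleftrightarrow> (let s = same_component M in s (VCopy 1 (X n)) (VCopy 3 (Y n)) \<or>
        s (VCopy 1 (X n)) (VCopy 1 (Y n)) \<and> s (VCopy 2 (Y n)) (VCopy 3 (Y n)) \<or>
        s (VCopy 1 (X n)) (VCopy 2 (Y n)) \<and> s (VCopy 1 (Y n)) (VCopy 3 (Y n)))"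
      unfolding ins M_def linked_def X.simps Y.simps
      by (rule same_component_insert_edge[OF notin ends mem(2,3)])
    \<comment> \<open>Every detour through three copies contains copies 1 and 3 or copies 2 and 4,
      hence already a full path from X to Y; the other cases give the shorter formula in
      \<open>joined\<close>.\<close>
    have "linked (Suc n) E \<longleftrightarrow> joined True (c 1) (c 2) (c 3) (c 4)"
      unfolding 2 Let_def same joined_def c_def by blast
    then show ?thesis
      using True 1 unfolding same c_def merges_def by (simp split: if_splits)
  next
    case False
    then have "E = E'" by (simp add: E'_def)
    then have "(G (Suc n))\<lparr>edges := E\<rparr> = M" by (simp add: M_def)
    then show ?thesis
      using False same(1) by (simp add: linked_def[of "Suc n"] merges_def joined_def c_def)
  qed
  with num show "comps (Suc n) E + merges (ENew \<in> E) (c 1) (c 2) (c 3) (c 4) =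
      (\<Sum>i\<in>{1..4}. comps n (ECopy i -` E))"
    and "linked (Suc n) E \<longleftrightarrow> joined (ENew \<in> E) (c 1) (c 2) (c 3) (c 4)"
    by simp_all
qed

lemma card_edges_Suc:
  assumes E: "E \<subseteq> edges (G (Suc n))"
  shows "card E = of_bool (ENew \<in> E) + (\<Sum>i\<in>{1..4}. card (ECopy i -` E))"
proof -
  have fin: "finite E" using E finite_edges_G by (rule finite_subset)
  then have fini: "finite (ECopy i -` E)" for i
    by (rule finite_vimageI) (simp add: inj_def)
  have "E - {ENew} = (\<Union>i\<in>{1..4}. ECopy i ` (ECopy i -` E))"
  proof (intro set_eqI iffI)
    fix e assume e: "e \<in> E - {ENew}"
    then have "e \<in> edges (G (Suc n))" using E by blast
    then have "e \<in> (\<Union>i\<in>{1..4}. ECopy i ` edges (G n))"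
      using e by (simp add: edges_G_Suc)
    then show "e \<in> (\<Union>i\<in>{1..4}. ECopy i ` (ECopy i -` E))"
      using e by auto
  qed auto
  moreover have "card (\<Union>i\<in>{1..4}. ECopy i ` (ECopy i -` E)) =
      (\<Sum>i\<in>{1..4}. card (ECopy i ` (ECopy i -` E)))"
    using fini by (intro card_UN_disjoint) blast+
  ultimately have "card (E - {ENew}) = (\<Sum>i\<in>{1..4}. card (ECopy i ` (ECopy i -` E)))"
    by simp
  also have "\<dots> = (\<Sum>i\<in>{1..4}. card (ECopy i -` E))"
    by (intro sum.cong refl card_image) (simp add: inj_on_def)
  finally have "card (E - {ENew}) = (\<Sum>i\<in>{1..4}. card (ECopy i -` E))" .
  moreover have "card E = of_bool (ENew \<in> E) + card (E - {ENew})"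
    using card_Suc_Diff1[OF fin, of ENew] by (cases "ENew \<in> E") simp_all
  ultimately show ?thesis by simp
qed

section \<open>The base graph and the connectedness of all \<open>G n\<close>\<close>

lemma num_comps_one_same_component:
  assumes "num_comps M = 1" "u \<in> verts M" "v \<in> verts M"
  shows "same_component M u v"
proof -
  obtain C where C: "components M = {C}"
    using assms(1) by (auto simp: num_comps_def card_1_singleton_iff)
  have "conn M `` {u} \<in> components M" "conn M `` {v} \<in> components M"
    using assms by (simp_all add: components_eq quotientI)
  then have "conn M `` {u} = conn M `` {v}" using C by simp
  then have "(u, v) \<in> conn M"
    using eq_equiv_class_iff[OF equiv_conn assms(2,3)] by simp
  then show ?thesis by (simp add: conn_iff)
qed

lemma K2_comps:
  "comps 0 {} = 2" "\<not> linked 0 {}" "comps 0 {EBase} = 1" "linked 0 {EBase}"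
proof -
  show a: "comps 0 {} = 2"
    by (simp add: num_comps_no_edges) (simp add: K2_def)
  show b: "\<not> linked 0 {}"
    by (simp add: linked_def same_component_iff adj_rel_def)
  show "comps 0 {EBase} = 1"
    using num_comps_insert_edge[of EBase "{}" "G 0" "X 0" "Y 0"] a b
    by (simp add: linked_def[of 0]) (simp add: K2_def)
  then show "linked 0 {EBase}"
    unfolding linked_def by (rule num_comps_one_same_component) (simp_all add: K2_def)
qed

text \<open>For the full edge set all copies are linked, so \<open>merges\<close> is 3 and the four
  components of the copies leave 4 - 3 = 1.\<close>

lemma num_comps_G: "num_comps (G n) = 1"
proof (induction n)
  case 0
  have "(G 0)\<lparr>edges := {EBase}\<rparr> = G 0" by (simp add: K2_def)
  then show ?case using K2_comps(3) by metis
next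
  case (Suc n)
  let ?E = "edges (G (Suc n))"
  have E: "ECopy i -` ?E = edges (G n)" if "i \<in> {1..4}" for i
    using that by (auto simp: edges_G_Suc image_iff)
  have l: "linked n (edges (G n))"
    unfolding linked_def edges_update_id
    by (rule num_comps_one_same_component[OF Suc X_in_G Y_in_G])
  have "comps (Suc n) ?E + merges True True True True True = (\<Sum>i\<in>{1..4::nat}. 1)"
    using comps_Suc[OF order_refl, of n] E l Suc
    by (simp add: edges_update_id edges_G_Suc)
  then show ?case by (simp add: merges_def edges_update_id)
qed

section \<open>Weights of edge sets and their factorization over the copies\<close>

definition weight :: "nat \<Rightarrow> ename set \<Rightarrow> bipoly" where
  "weight n E = tutte_term (G n) ((G n)\<lparr>edges := E\<rparr>)"

lemma comps_pos: "1 \<le> comps n E"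
  using finite_verts_G X_in_G by (intro num_comps_pos) auto

text \<open>As \<open>G n\<close> is connected, the rank difference is k(H) - 1. The bounds 1 <=
  k(H) <= |V| justify this computation in natural numbers.\<close>

lemma weight_eq:
  "weight n E = (var_x - 1) ^ (comps n E - 1) *
    (var_y - 1) ^ (card E + comps n E - card (verts (G n)))"
proof -
  have "comps n E \<le> card (verts (G n))"
    using num_comps_le_verts[of "(G n)\<lparr>edges := E\<rparr>"] finite_verts_G by simp
  then show ?thesis
    using comps_pos[of E n]
    by (simp add: weight_def tutte_term_def rank_def nullity_def num_comps_G)
qed

text \<open>
  The exponent of \<open>x - 1\<close> is raised by 2 over the true one, \<open>3 - m\<close>, which can be negative.
\<close>

definition factor :: "bool \<Rightarrow> bool \<Rightarrow> bool \<Rightarrow> bool \<Rightarrow> bool \<Rightarrow> bipoly" where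
  "factor d c1 c2 c3 c4 = (let m = merges d c1 c2 c3 c4 in
    (var_x - 1) ^ (5 - m) * (var_y - 1) ^ (4 + of_bool d - m))"

lemma sum_four: "(\<Sum>i\<in>{1..4::nat}. f i) = f 1 + f 2 + f 3 + (f 4 :: nat)"
  by (simp add: numeral_eq_Suc)

text \<open>Both exponents are additive over the copies up to a correction: with \<open>m\<close>
  mergers, k - 1 gains 3 - \<open>m\<close>, and, as four vertices are lost, the nullity gains 4 + d
  - \<open>m\<close>. Since \<open>m\<close> is at most 5, the square of x - 1 clears the negative
  exponents.\<close>

lemma weight_Suc:
  assumes E: "E \<subseteq> edges (G (Suc n))"
  defines "F \<equiv> \<lambda>i. ECopy i -` E"
  shows "(var_x - 1) ^ 2 * weight (Suc n) E =
    factor (ENew \<in> E) (linked n (F 1)) (linked n (F 2)) (linked n (F 3)) (linked n (F 4)) *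
    (weight n (F 1) * weight n (F 2) * weight n (F 3) * weight n (F 4))"
proof -
  let ?v = "card (verts (G n))" and ?d = "of_bool (ENew \<in> E) :: nat"
  define m where "m = merges (ENew \<in> E) (linked n (F 1)) (linked n (F 2)) (linked n (F 3)) (linked n (F 4))"
  have m: "m \<le> 4 + ?d" "m \<le> 5" by (auto simp: m_def merges_def)
  have comps: "comps (Suc n) E + m = comps n (F 1) + comps n (F 2) + comps n (F 3) + comps n (F 4)"
    using comps_Suc[OF E] unfolding sum_four m_def F_def .
  have card: "card E = ?d + (card (F 1) + card (F 2) + card (F 3) + card (F 4))"
    using card_edges_Suc[OF E] unfolding sum_four F_def .
  have ge: "?v \<le> card (F i) + comps n (F i)" if "i \<in> {1..4}" for i
    using that E unfolding F_def edges_G_Suc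
    by (intro verts_le_edges_plus_comps[OF wf_G]) auto
  \<comment> \<open>\<open>r i\<close> is the nullity of the \<open>i\<close>-th part; by
    \<open>ge\<close> it can be used additively, free of truncation.\<close>
  define r where "r i = card (F i) + comps n (F i) - ?v" for i
  have r: "card (F i) + comps n (F i) = ?v + r i" if "i \<in> {1..4}" for i
    using ge[OF that] by (simp add: r_def)
  have x: "2 + (comps (Suc n) E - 1) = (5 - m) +
      ((comps n (F 1) - 1) + (comps n (F 2) - 1) + (comps n (F 3) - 1) + (comps n (F 4) - 1))"
    using comps m comps_pos[of E "Suc n"] comps_pos[of "F 1" n] comps_pos[of "F 2" n]
      comps_pos[of "F 3" n] comps_pos[of "F 4" n] by linarith
  have "card E + comps (Suc n) E = card (verts (G (Suc n))) + ((4 + ?d - m) + (r 1 + r 2 + r 3 + r 4))"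
    using comps card m(1) r[of 1] r[of 2] r[of 3] r[of 4] card_verts_G_Suc[of n] by simp
  then have y: "card E + comps (Suc n) E - card (verts (G (Suc n))) =
      (4 + ?d - m) + (r 1 + r 2 + r 3 + r 4)"
    by simp
  have "(var_x - 1) ^ 2 * weight (Suc n) E = (var_x - 1) ^ (2 + (comps (Suc n) E - 1)) *
    (var_y - 1) ^ (card E + comps (Suc n) E - card (verts (G (Suc n))))"
    unfolding weight_eq power_add by (simp only: mult.assoc)
  also have "\<dots> = factor (ENew \<in> E) (linked n (F 1)) (linked n (F 2)) (linked n (F 3)) (linked n (F 4)) *
    (weight n (F 1) * weight n (F 2) * weight n (F 3) * weight n (F 4))"
    unfolding x y power_add weight_eq factor_def r_def Let_def m_def[symmetric] by (simp only: mult_ac)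
  finally show ?thesis .
qed

subsection \<open>Summation over spanning subgraphs\<close>

lemma spanning_subgraphs_eq: "spanning_subgraphs M = (\<lambda>E. M\<lparr>edges := E\<rparr>) ` Pow (edges M)"
proof -
  have "H \<in> spanning_subgraphs M \<longleftrightarrow> (\<exists>E\<subseteq>edges M. H = M\<lparr>edges := E\<rparr>)" for H
    by (cases H; cases M) (auto simp: spanning_subgraphs_def)
  then show ?thesis by blast
qed

lemma sum_spanning_subgraphs:
  "(\<Sum>H\<in>{H \<in> spanning_subgraphs M. P H}. f H) =
    (\<Sum>E\<in>{E \<in> Pow (edges M). P (M\<lparr>edges := E\<rparr>)}. f (M\<lparr>edges := E\<rparr>))"
proof -
  have "{H \<in> spanning_subgraphs M. P H} =
      (\<lambda>E. M\<lparr>edges := E\<rparr>) ` {E \<in> Pow (edges M). P (M\<lparr>edges := E\<rparr>)}"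
    unfolding spanning_subgraphs_eq by blast
  moreover have "inj (\<lambda>E. M\<lparr>edges := E\<rparr>)"
    by (rule injI, cases M) simp
  ultimately show ?thesis
    by (simp add: sum.reindex inj_on_subset[OF _ subset_UNIV])
qed

text \<open>Both partial sums as one family indexed by a truth value, so that a connection pattern
  of the copies can serve as a summation index.\<close>

definition linked_sum :: "nat \<Rightarrow> bool \<Rightarrow> bipoly" where
  "linked_sum n s = (\<Sum>E\<in>Pow (edges (G n)). of_bool (linked n E = s) * weight n E)"

lemma T1_eq: "T1 n = linked_sum n True"
  and T2_eq: "T2 n = linked_sum n False"
  unfolding T1_def T2_def linked_sum_def sum_spanning_subgraphs linked_def weight_def
  using finite_edges_G[of n]
  by (auto simp: sum.inter_filter intro!: sum.cong)

text \<open>Groups edge sets by whether they connect the terminals; this replaces the sum over one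
  copy by a sum of two terms.\<close>

lemma sum_linked:
  "(\<Sum>E\<in>Pow (edges (G n)). f (linked n E) * weight n E) =
    (\<Sum>s\<in>UNIV. f s * linked_sum n s)"
proof -
  have "(\<Sum>s\<in>UNIV. f s * linked_sum n s) =
    (\<Sum>E\<in>Pow (edges (G n)). f True * (of_bool (linked n E) * weight n E) +
      f False * (of_bool (\<not> linked n E) * weight n E))"
    by (simp add: UNIV_bool linked_sum_def sum_distrib_left sum.distrib)
  also have "\<dots> = (\<Sum>E\<in>Pow (edges (G n)). f (linked n E) * weight n E)"
    by (intro sum.cong) auto
  finally show ?thesis ..
qed

text \<open>An edge set of \<open>G (Suc n)\<close> corresponds to the presence of
  \<open>ENew\<close> and four independent edge sets of \<open>G n\<close>; \<open>split\<close> and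
  \<open>join\<close> are the mutually inverse maps.\<close>

lemma sum_Pow_edges_Suc:
  "(\<Sum>E\<in>Pow (edges (G (Suc n))). f (ENew \<in> E) (ECopy 1 -` E) (ECopy 2 -` E) (ECopy 3 -` E) (ECopy 4 -` E)) =
    (\<Sum>d\<in>UNIV. \<Sum>E1\<in>Pow (edges (G n)). \<Sum>E2\<in>Pow (edges (G n)).
      \<Sum>E3\<in>Pow (edges (G n)). \<Sum>E4\<in>Pow (edges (G n)). f d E1 E2 E3 E4)"
proof -
  define split where
    "split E = (ENew \<in> E, ECopy 1 -` E, ECopy 2 -` E, ECopy 3 -` E, ECopy 4 -` E)" for E
  define join where "join = (\<lambda>(d, E1, E2, E3, E4). (if d then {ENew} else {}) \<union>
    ECopy 1 ` E1 \<union> ECopy 2 ` E2 \<union> ECopy 3 ` E3 \<union> ECopy 4 ` E4)"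
  let ?P = "Pow (edges (G n))"
  have four: "{1..4} = {1, 2, 3, 4::nat}" by auto
  have "(\<Sum>E\<in>Pow (edges (G (Suc n))). case split E of (d, E1, E2, E3, E4) \<Rightarrow> f d E1 E2 E3 E4) =
    (\<Sum>(d, E1, E2, E3, E4) \<in> UNIV \<times> ?P \<times> ?P \<times> ?P \<times> ?P. f d E1 E2 E3 E4)"
  proof (rule sum.reindex_bij_witness[where i = join and j = split])
    fix E assume "E \<in> Pow (edges (G (Suc n)))"
    then have E: "E \<subseteq> insert ENew (\<Union>i\<in>{1, 2, 3, 4}. ECopy i ` edges (G n))"
      unfolding edges_G_Suc four by blast
    then show "join (split E) = E" by (auto simp: join_def split_def)
    show "split E \<in> UNIV \<times> ?P \<times> ?P \<times> ?P \<times> ?P" using E by (auto simp: split_def)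
  next
    fix p :: "bool \<times> ename set \<times> ename set \<times> ename set \<times> ename set"
    assume p: "p \<in> (UNIV :: bool set) \<times> ?P \<times> ?P \<times> ?P \<times> ?P"
    show "split (join p) = p" by (auto simp: join_def split_def split: prod.splits)
    show "join p \<in> Pow (edges (G (Suc n)))"
      using p unfolding edges_G_Suc four join_def by (auto split: if_splits)
  qed simp
  then show ?thesis by (simp add: split_def sum.cartesian_product)
qed

lemma linked_sum_Suc:
  "(var_x - 1) ^ 2 * linked_sum (Suc n) s =
    (\<Sum>d\<in>UNIV. \<Sum>c1\<in>UNIV. \<Sum>c2\<in>UNIV. \<Sum>c3\<in>UNIV. \<Sum>c4\<in>UNIV.
      of_bool (joined d c1 c2 c3 c4 = s) * factor d c1 c2 c3 c4 *
      (linked_sum n c1 * linked_sum n c2 * linked_sum n c3 * linked_sum n c4))"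
proof -
  define h where "h d c1 c2 c3 c4 = of_bool (joined d c1 c2 c3 c4 = s) * factor d c1 c2 c3 c4"
    for d c1 c2 c3 c4
  let ?P = "Pow (edges (G n))" and ?l = "linked n" and ?w = "weight n" and ?S = "linked_sum n"
  have "(var_x - 1) ^ 2 * linked_sum (Suc n) s =
    (\<Sum>E\<in>Pow (edges (G (Suc n))). of_bool (linked (Suc n) E = s) * ((var_x - 1) ^ 2 * weight (Suc n) E))"
    by (simp add: linked_sum_def sum_distrib_left mult_ac)
  also have "\<dots> = (\<Sum>E\<in>Pow (edges (G (Suc n))). (\<lambda>d E1 E2 E3 E4.
      h d (?l E1) (?l E2) (?l E3) (?l E4) * (?w E1 * ?w E2 * ?w E3 * ?w E4))
      (ENew \<in> E) (ECopy 1 -` E) (ECopy 2 -` E) (ECopy 3 -` E) (ECopy 4 -` E))"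
    by (intro sum.cong refl) (simp only: Pow_iff weight_Suc linked_Suc h_def mult.assoc)
  also have "\<dots> = (\<Sum>d\<in>UNIV. \<Sum>E1\<in>?P. \<Sum>E2\<in>?P. \<Sum>E3\<in>?P. \<Sum>E4\<in>?P.
      h d (?l E1) (?l E2) (?l E3) (?l E4) * (?w E1 * ?w E2 * ?w E3 * ?w E4))"
    by (rule sum_Pow_edges_Suc)
  \<comment> \<open>After this nesting, the factor beside each weight depends on that copy's edge
    set only through \<open>linked\<close>, so \<open>sum_linked\<close> applies from copy 4
    outwards.\<close>
  also have "\<dots> = (\<Sum>d\<in>UNIV. \<Sum>E1\<in>?P. (\<Sum>E2\<in>?P. (\<Sum>E3\<in>?P. (\<Sum>E4\<in>?P.
      h d (?l E1) (?l E2) (?l E3) (?l E4) * ?w E4) * ?w E3) * ?w E2) * ?w E1)"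
    by (simp only: sum_distrib_left sum_distrib_right mult_ac)
  also have "\<dots> = (\<Sum>d\<in>UNIV. \<Sum>c1\<in>UNIV. (\<Sum>c2\<in>UNIV. (\<Sum>c3\<in>UNIV. (\<Sum>c4\<in>UNIV.
      h d c1 c2 c3 c4 * ?S c4) * ?S c3) * ?S c2) * ?S c1)"
    by (simp only: sum_linked
      sum_linked[where f = "\<lambda>c3. \<Sum>c4\<in>UNIV. h d c1 c2 c3 c4 * ?S c4" for d c1 c2]
      sum_linked[where f = "\<lambda>c2. \<Sum>c3\<in>UNIV. (\<Sum>c4\<in>UNIV. h d c1 c2 c3 c4 * ?S c4) * ?S c3" for d c1]
      sum_linked[where f = "\<lambda>c1. \<Sum>c2\<in>UNIV. (\<Sum>c3\<in>UNIV.
        (\<Sum>c4\<in>UNIV. h d c1 c2 c3 c4 * ?S c4) * ?S c3) * ?S c2" for d])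
  also have "\<dots> = (\<Sum>d\<in>UNIV. \<Sum>c1\<in>UNIV. \<Sum>c2\<in>UNIV. \<Sum>c3\<in>UNIV. \<Sum>c4\<in>UNIV.
      h d c1 c2 c3 c4 * (?S c1 * ?S c2 * ?S c3 * ?S c4))"
    by (simp only: sum_distrib_left sum_distrib_right mult_ac)
  finally show ?thesis unfolding h_def .
qed

section \<open>The recursion and its initial values\<close>

text \<open>The 32 cases are expanded. For instance, 2x + 2 = 2(x - 1) + 4: with two copies linked,
  X and Y are joined in two patterns without the new edge (\<open>m\<close> = 4) and in four with it
  (\<open>m\<close> = 5).\<close>

lemma T1_Suc:
  "(var_x - 1) ^ 2 * T1 (Suc n) = var_y * (var_y - 1) * (var_x - 1) ^ 2 * T1 n ^ 4
    + 4 * var_y * (var_x - 1) * T1 n ^ 3 * T2 n + (2 * var_x + 2) * T1 n ^ 2 * T2 n ^ 2"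
proof -
  define a b where "a = var_x - 1" and "b = var_y - 1"
  then have xy: "var_x = a + 1" "var_y = b + 1" by simp_all
  show ?thesis
    unfolding T1_eq T2_eq linked_sum_Suc
    by (simp add: UNIV_bool joined_def factor_def merges_def a_def[symmetric] b_def[symmetric])
      (simp add: xy algebra_simps power2_eq_square power3_eq_cube power4_eq_xxxx)
qed

text \<open>The complementary cases. The coefficient x of the last term is (x - 1) + 1: no copy is
  linked, and the new edge is absent or present.\<close>

lemma T2_Suc:
  "(var_x - 1) ^ 2 * T2 (Suc n) = (2 * var_y + 2) * (var_x - 1) * T1 n ^ 2 * T2 n ^ 2
    + 4 * var_x * T1 n * T2 n ^ 3 + var_x * T2 n ^ 4"
proof -
  define a b where "a = var_x - 1" and "b = var_y - 1"
  then have xy: "var_x = a + 1" "var_y = b + 1" by simp_all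
  show ?thesis
    unfolding T1_eq T2_eq linked_sum_Suc
    by (simp add: UNIV_bool joined_def factor_def merges_def a_def[symmetric] b_def[symmetric])
      (simp add: xy algebra_simps power2_eq_square power3_eq_cube power4_eq_xxxx)
qed

lemma T_eq: "T n = T1 n + T2 n"
proof -
  have "finite (spanning_subgraphs (G n))"
    using finite_edges_G by (simp add: spanning_subgraphs_eq)
  then show ?thesis
    unfolding T_def tutte_def T1_def T2_def by (subst sum.union_disjoint[symmetric]) (auto intro: sum.cong)
qed

lemma T_0: "T1 0 = 1" "T2 0 = var_x - 1"
proof -
  have P: "Pow (edges (G 0)) = {{}, {EBase}}" by (auto simp: K2_def)
  have v: "card (verts (G 0)) = 2" by (simp add: K2_def)
  have "weight 0 {} = var_x - 1" "weight 0 {EBase} = 1"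
    unfolding weight_eq v K2_comps by simp_all
  then show "T1 0 = 1" "T2 0 = var_x - 1"
    unfolding T1_eq T2_eq linked_sum_def P by (simp_all add: K2_comps)
qed

lemma var_x_neq_1: "var_x - 1 \<noteq> 0"
  by (simp add: var_x_def one_pCons)

text \<open>Divides the cleared recursions by the square of x - 1 in the fraction field.\<close>

lemma solve_square_mult:
  fixes a :: "'a :: field"
  assumes "a \<noteq> 0" "a ^ 2 * r = p * a ^ 2 + q * a + s"
  shows "r = p + q / a + s / a ^ 2"
proof -
  have "a ^ 2 * r = a ^ 2 * (p + q / a + s / a ^ 2)"
    unfolding assms(2) using assms(1) by (simp add: distrib_left power2_eq_square)
  then show ?thesis using assms(1) by simp
qed

theorem theorem1:
  shows "(\<forall>n. T (Suc n) = T1 (Suc n) + T2 (Suc n)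
    \<and> R1 (Suc n) = ry * (ry - 1) * R1 n ^ 4
        + 4 * ry / (rx - 1) * R1 n ^ 3 * R2 n
        + (2 * rx + 2) / (rx - 1) ^ 2 * R1 n ^ 2 * R2 n ^ 2
    \<and> R2 (Suc n) = (2 * ry + 2) / (rx - 1) * R1 n ^ 2 * R2 n ^ 2
        + 4 * rx / (rx - 1) ^ 2 * R1 n * R2 n ^ 3
        + rx / (rx - 1) ^ 2 * R2 n ^ 4)
    \<and> T1 0 = 1 \<and> T2 0 = var_x - 1"
proof (intro conjI allI T_eq T_0)
  have ne: "rx - 1 \<noteq> 0"
    using var_x_neq_1 by (metis to_fract_1 to_fract_diff to_fract_eq_0_iff)
  \<comment> \<open>Together with \<open>num\<close>, this lets \<open>to_fract\<close> be pushed
    through the polynomial identities as a ring homomorphism.\<close>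
  have pow: "to_fract (p ^ k) = to_fract p ^ k" for p :: bipoly and k
    by (induction k) simp_all
  have num: "to_fract (numeral k) = (numeral k :: bipoly fract)" for k
    by (induction k) (simp_all only: numeral.simps to_fract_add to_fract_1)
  note hom = pow num to_fract_add to_fract_diff to_fract_mult to_fract_1
  fix n
  have "(rx - 1) ^ 2 * R1 (Suc n) = (ry * (ry - 1) * R1 n ^ 4) * (rx - 1) ^ 2
      + (4 * ry * R1 n ^ 3 * R2 n) * (rx - 1) + (2 * rx + 2) * R1 n ^ 2 * R2 n ^ 2"
    using arg_cong[OF T1_Suc[of n], of to_fract] by (simp only: hom mult_ac)
  from solve_square_mult[OF ne this] show "R1 (Suc n) = ry * (ry - 1) * R1 n ^ 4
        + 4 * ry / (rx - 1) * R1 n ^ 3 * R2 n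
        + (2 * rx + 2) / (rx - 1) ^ 2 * R1 n ^ 2 * R2 n ^ 2"
    by (simp only: times_divide_eq_left)
  \<comment> \<open>The zero fills the place of \<open>p\<close>, as no term here is free of a
    denominator; the two terms over the square together form \<open>s\<close>.\<close>
  have "(rx - 1) ^ 2 * R2 (Suc n) = 0 * (rx - 1) ^ 2
      + ((2 * ry + 2) * R1 n ^ 2 * R2 n ^ 2) * (rx - 1)
      + (4 * rx * R1 n * R2 n ^ 3 + rx * R2 n ^ 4)"
    using arg_cong[OF T2_Suc[of n], of to_fract]
    by (simp only: hom mult_ac add.assoc mult_zero_left mult_zero_right add_0)
  from solve_square_mult[OF ne this] show "R2 (Suc n) = (2 * ry + 2) / (rx - 1) * R1 n ^ 2 * R2 n ^ 2
        + 4 * rx / (rx - 1) ^ 2 * R1 n * R2 n ^ 3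
        + rx / (rx - 1) ^ 2 * R2 n ^ 4"
    by (simp only: times_divide_eq_left add_divide_distrib[of "4 * rx * R1 n * R2 n ^ 3"] add.assoc add_0)
qed

end
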